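(* The $q$-deformed Virasoro algebra ($m,n\in 2\mathbb{Z}$) $$[t_n,t_m]=\sum_{l\in 2\mathbb{Z}\setminus\{0\}} -f_l\,(t_{n-l}t_{m+l}-t_{m-l}t_{n+l}),$$ where the structure constants $f_l$ are the symmetrized coefficients $f_l=\tfrac12(f^{(0)}_l+f^{(1)}_l)$ of the function $f(z)$ defined in the context, admits a central extension of the form $$h_{n,m}=\xi_{n+m}\left(q^{\frac12(n-m)}-q^{\frac12(m-n)}\right),$$ where $\xi_n$ is a completely arbitrary function of $n$.
   Context: Here $q$ (deformation parameter) and $p$ (elliptic nome) are the parameters of the algebra, and the generators are $t_n$, $n\in 2\mathbb{Z}$. Let $$f(z)=\frac{1}{(1-z^2)^2}\prod_{j\ge 0}\frac{(1-z^2pq^{4j})^2(1-z^2p^{-1}q^{4j+2})^2}{(1-z^2pq^{4j+2})^2(1-z^2p^{-1}q^{4j+4})^2}.$$ The numbers $f^{(0)}_l$ and $f^{(1)}_l$ are respectively the coefficients of $z^l$ in the series expansions of the meromorphic function $f(z)$ inside the convergence disk $|z|<1$ and in the convergence ring $1<|z|<|p^{-1/2}q^{-1}|$. A centrally extended version of the algebra has the form $$[t_n,t_m]=\sum_{l\in 2\mathbb{Z}\setminus\{0\}} -f_l\,(t_{n-l}t_{m+l}-t_{m-l}t_{n+l})+h_{n,m}$$ with $h_{n,m}$ central. Imposing the Jacobi identity on $t_n,t_m,t_r$ leads to the following cocycle condition for $h$, to be satisfied for all $n,m,r,s\in 2\mathbb{Z}$: $$\sum_{k\in 2\mathbb{Z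}}\big(f_{k-n}f_{s-r-k}-f_{n-k}f_{k+r-s}+f_{k-m}f_{s-n-k}-f_{m-k}f_{k+n-s}+f_{k-r}f_{s-m-k}-f_{r-k}f_{k+m-s}\big)\,h_{s-k,k}=0.$$
   Formalization: The sum over k in the cocycle condition diverges in general, so it is taken as the limit over windows symmetric under k -> s-k (pairing h_{s-k,k} with h_{k,s-k}); parameters satisfy 0<|q|<=|p|<1, so that the stated ring is the convergence ring. *)

theory Defs
  imports "HOL-Analysis.Analysis"
begin

definition qvir_fun :: "complex \<Rightarrow> complex \<Rightarrow> complex \<Rightarrow> complex" where
  "qvir_fun p q z = 1 / (1 - z\<^sup>2)\<^sup>2 *
     (\<Prod>j. ((1 - z\<^sup>2 * p * q ^ (4 * j))\<^sup>2 * (1 - z\<^sup>2 * inverse p * q ^ (4 * j + 2))\<^sup>2) /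
           ((1 - z\<^sup>2 * p * q ^ (4 * j + 2))\<^sup>2 * (1 - z\<^sup>2 * inverse p * q ^ (4 * j + 4))\<^sup>2))"

(* On the disk ball 0 1 the coefficients of negative index come out as 0. *)
definition laurent_coeff_on :: "(complex \<Rightarrow> complex) \<Rightarrow> complex set \<Rightarrow> int \<Rightarrow> complex" where
  "laurent_coeff_on g A = (THE c. \<forall>z\<in>A. ((\<lambda>l. c l * z powi l) has_sum g z) UNIV)"

definition qvir_ring :: "complex \<Rightarrow> complex \<Rightarrow> complex set" where
  "qvir_ring p q = {z. 1 < norm z \<and> norm z < 1 / (sqrt (norm p) * norm q)}"

definition qvir_coeff :: "complex \<Rightarrow> complex \<Rightarrow> int \<Rightarrow> complex" where
  "qvir_coeff p q l = (laurent_coeff_on (qvir_fun p q) (ball 0 1) l +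
                       laurent_coeff_on (qvir_fun p q) (qvir_ring p q) l) / 2"

definition cocycle_coeff :: "(int \<Rightarrow> complex) \<Rightarrow> int \<Rightarrow> int \<Rightarrow> int \<Rightarrow> int \<Rightarrow> int \<Rightarrow> complex" where
  "cocycle_coeff f n m r s k =
     f (k - n) * f (s - r - k) - f (n - k) * f (k + r - s) +
     f (k - m) * f (s - n - k) - f (m - k) * f (k + n - s) +
     f (k - r) * f (s - m - k) - f (r - k) * f (k + m - s)"

(* h is a central term for the algebra on generators t_n (n even)
     [t_n, t_m] = (sum over even l \<noteq> 0) - f_l (t_(n-l) t_(m+l) - t_(m-l) t_(n+l)) + h_(n,m)
   when it is antisymmetric, like the bracket, and satisfies the condition that the Jacobi
   identity on t_n, t_m, t_r imposes on it.  That condition is a sum over all even k against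
   h_(s-k,k) = - h_(k,s-k), so k and s - k contribute multiples of the same central element
   and have to be collected together: the sum is the limit of the partial sums over windows
   invariant under k \<mapsto> s - k.  Without this pairing it would not converge: for the structure
   constants qvir_coeff, cocycle_coeff in general tends to the same nonzero constant for
   k \<rightarrow> \<infinity> and k \<rightarrow> -\<infinity>, while h_(s-k,k) grows exponentially. *)
definition central_extension_cocycle :: "(int \<Rightarrow> complex) \<Rightarrow> (int \<Rightarrow> int \<Rightarrow> complex) \<Rightarrow> bool" where
  "central_extension_cocycle f h \<longleftrightarrow>
     (\<forall>n m. even n \<longrightarrow> even m \<longrightarrow> h m n = - h n m) \<and>
     (\<forall>n m r s. even n \<longrightarrow> even m \<longrightarrow> even r \<longrightarrow> even s \<longrightarrow>
        (\<lambda>N::nat. \<Sum>k | even k \<and> \<bar>2 * k - s\<bar> \<le> int N. cocycle_coeff f n m r s k * h (s - k) k)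
          \<longlonglongrightarrow> 0)"

end

(* In x = z^2 the structure function is F(x) = g(x) / (1 - x)^2 with g holomorphic on
   |x| < 1 / (|p| |q|^2).  The infinite products telescope to F(x) F(q^2 x) = G(x), a rational
   function with G(1/x) = G(x / q^2).  Let f0 and f1 be the coefficients of F inside and outside
   the pole x = 1, and D = f0 - f1, which is affine in the index.  For f = (f0 + f1) / 2,
     f_i f_j = (f0_i f0_j + f1_i f1_j) / 2 - D_i D_j / 4,
   so f_i f_(m-i) - f_(-i) f_(i-m) is a constant plus half of
     (f1_i f1_(m-i) - f0_(-i) f0_(i-m)) + (f0_i f0_(m-i) - f1_(-i) f1_(i-m)).
   Summed against q^(-2i), the two products in the first bracket give the same coefficient of
   G(x / q^2) = G(1/x) on 1 < |x| < 1/|p|, and those in the second bracket on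
   |p| |q|^2 < |x| < |q|^2.  The constant is killed by the antisymmetry of h on the symmetric
   summation windows. *)
theory Submission
  imports Defs "HOL-Complex_Analysis.Cauchy_Integral_Formula"
begin

section \<open>Laurent series as unordered sums over the integers\<close>

lemma has_sum_sum:
  fixes f :: "'a \<Rightarrow> 'b \<Rightarrow> 'c :: topological_comm_monoid_add"
  assumes "finite I" and "\<And>i. i \<in> I \<Longrightarrow> (f i has_sum s i) A"
  shows "((\<lambda>x. \<Sum>i\<in>I. f i x) has_sum (\<Sum>i\<in>I. s i)) A"
  using assms by (induction I rule: finite_induct) (auto intro: has_sum_add)

lemma has_sum_diff:
  fixes f g :: "'a \<Rightarrow> 'b :: topological_ab_group_add"
  assumes "(f has_sum a) A" and "(g has_sum b) A"
  shows "((\<lambda>x. f x - g x) has_sum a - b) A"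
  using has_sum_add[OF assms(1), of "\<lambda>x. - g x" "- b"] assms(2) by (simp add: has_sum_uminus)

lemma has_sum_int_convolution:
  fixes A B :: "int \<Rightarrow> complex"
  assumes A: "(A has_sum a) UNIV" and B: "(B has_sum b) UNIV"
  shows "((\<lambda>m. \<Sum>\<^sub>\<infinity>i. A i * B (m - i)) has_sum a * b) UNIV"
    and "(\<lambda>i. A i * B (m - i)) summable_on UNIV"
proof -
  have nA: "(\<lambda>i. norm (A i)) summable_on UNIV" and nB: "(\<lambda>i. norm (B i)) summable_on UNIV"
    using A B by (auto simp flip: summable_on_iff_abs_summable_on_complex simp: has_sum_imp_summable)
  have "(\<lambda>x. norm ((\<lambda>(i,j). A i * B j) x)) summable_on (SIGMA i:UNIV. UNIV)"
    by (subst Infinite_Sum.abs_summable_on_Sigma_iff)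
       (use nA nB in \<open>auto simp: norm_mult infsum_cmult_right' abs_mult infsum_nonneg intro!: summable_on_cmult_right summable_on_cmult_left\<close>)
  hence "(\<lambda>(i,j). A i * B j) summable_on (SIGMA i:UNIV. UNIV)"
    by (rule Infinite_Sum.abs_summable_summable)
  then obtain S where S: "((\<lambda>(i,j). A i * B j) has_sum S) (SIGMA i:UNIV. UNIV)"
    by (auto simp: summable_on_def)
  have "((\<lambda>i. A i * b) has_sum S) UNIV"
    by (rule has_sum_Sigma'[OF S]) (use B in \<open>auto intro: has_sum_cmult_right\<close>)
  moreover have "((\<lambda>i. A i * b) has_sum a * b) UNIV"
    by (intro has_sum_cmult_left A)
  ultimately have [simp]: "S = a * b" by (rule has_sum_unique)
  have T: "((\<lambda>(m,i). A i * B (m - i)) has_sum a * b) (SIGMA m:UNIV. UNIV)"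
    by (subst has_sum_reindex_bij_witness[where i="\<lambda>(i,j). (i+j,i)" and j = "\<lambda>(m,i). (i,m-i)" and h = "\<lambda>(i,j). A i * B j" and s' = S and T = "SIGMA i:UNIV. UNIV"])
       (use S in auto)
  have sm: "(\<lambda>i. A i * B (m - i)) summable_on UNIV" for m
    using summable_on_SigmaD1[of "\<lambda>m i. A i * B (m - i)" UNIV "\<lambda>_. UNIV" m] T
    by (auto simp: has_sum_imp_summable)
  show "((\<lambda>m. \<Sum>\<^sub>\<infinity>i. A i * B (m - i)) has_sum a * b) UNIV"
    by (rule has_sum_Sigma'[OF T]) (use sm in auto)
  show "(\<lambda>i. A i * B (m - i)) summable_on UNIV" by fact
qed

lemma sum_root_of_unity:
  fixes N :: nat and d :: int
  assumes N: "N > 0"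
  shows "(\<Sum>k<N. (cis (2 * pi / real N) powi d) ^ k) = (if int N dvd d then of_nat N else 0)"
proof -
  define w where "w = cis (2 * pi / real N) powi d"
  have w: "w = cis (2 * pi * real_of_int d / real N)"
    unfolding w_def by (simp add: cis_power_int mult_ac)
  have wN: "w ^ N = 1"
  proof -
    have "w ^ N = cis (2 * pi * real_of_int d)"
      unfolding w using N by (subst Complex.DeMoivre) simp
    also have "\<dots> = 1" by (rule cis_multiple_2pi) auto
    finally show ?thesis .
  qed
  have w1: "w = 1 \<longleftrightarrow> int N dvd d"
  proof
    assume "w = 1"
    then obtain n :: int where "2 * pi * real_of_int d / real N = 2 * pi * of_int n"
      unfolding w complex_eq_iff by (auto simp: cos_one_2pi_int mult_ac)
    hence "real_of_int d = of_int (n * int N)" using N by (simp add: field_simps)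
    thus "int N dvd d" by (metis dvd_triv_right of_int_eq_iff)
  next
    assume "int N dvd d"
    then obtain n where "d = int N * n" by auto
    hence "2 * pi * real_of_int d / real N = 2 * pi * of_int n" using N by simp
    thus "w = 1" unfolding w by simp
  qed
  show ?thesis
  proof (cases "w = 1")
    case True thus ?thesis using w1 by (simp flip: w_def)
  next
    case False
    thus ?thesis using w1 wN by (simp flip: w_def add: sum_gp_strict)
  qed
qed

text \<open>Averaging over the \<open>N\<close>-th roots of unity leaves only the terms with index congruent to \<open>j\<close>
  modulo \<open>N\<close>; all of them but the \<open>j\<close>-th disappear as \<open>N\<close> grows.\<close>
lemma laurent_coeffs_zero:
  fixes e :: "int \<Rightarrow> complex"
  assumes r: "r > 0" and e: "\<And>z. norm z = r \<Longrightarrow> ((\<lambda>l. e l * z powi l) has_sum 0) UNIV"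
  shows "e j = 0"
proof -
  define u where "u l = e l * of_real r powi l" for l
  have u: "(u has_sum 0) UNIV" using e[of "of_real r"] r by (simp add: u_def[abs_def])
  have an: "(\<lambda>l. norm (u l)) summable_on UNIV"
    using u by (auto simp flip: summable_on_iff_abs_summable_on_complex simp: has_sum_imp_summable)
  have v: "((\<lambda>l. if int N dvd (l - j) then u l else 0) has_sum 0) UNIV" if N: "N > 0" for N
  proof -
    define w where "w = cis (2 * pi / real N)"
    have "((\<lambda>l. w powi (- j * int k) * (u l * w powi (l * int k))) has_sum w powi (-j * int k) * 0) UNIV" for k
    proof (rule has_sum_cmult_right)
      have "((\<lambda>l. e l * (of_real r * w ^ k) powi l) has_sum 0) UNIV"
        by (rule e) (use r in \<open>simp add: w_def norm_mult norm_power\<close>)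
      thus "((\<lambda>l. u l * w powi (l * int k)) has_sum 0) UNIV"
        by (simp add: u_def power_int_mult_distrib mult_ac flip: power_int_of_nat power_int_mult)
    qed
    hence "((\<lambda>l. \<Sum>k<N. w powi (- j * int k) * (u l * w powi (l * int k))) has_sum (\<Sum>k<N. 0)) UNIV"
      by (intro has_sum_sum) auto
    moreover have "(\<Sum>k<N. w powi (- j * int k) * (u l * w powi (l * int k))) = of_nat N * (if int N dvd (l - j) then u l else 0)" for l
    proof -
      have "w powi (- j * int k) * (u l * w powi (l * int k)) = u l * (w powi (l - j)) ^ k" for k
      proof -
        have "w powi (l * int k) * w powi (- j * int k) = w powi ((l - j) * int k)"
          by (subst power_int_add [symmetric]) (auto simp: w_def algebra_simps)
        also have "\<dots> = (w powi (l - j)) ^ k"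
          by (simp only: power_int_mult power_int_of_nat)
        finally show ?thesis by (simp add: mult_ac)
      qed
      hence "(\<Sum>k<N. w powi (- j * int k) * (u l * w powi (l * int k))) = u l * (\<Sum>k<N. (w powi (l - j)) ^ k)"
        by (simp only: sum_distrib_left)
      thus ?thesis using sum_root_of_unity[OF N, of "l - j"] by (simp add: w_def)
    qed
    ultimately have "((\<lambda>l. of_nat N * (if int N dvd (l - j) then u l else 0)) has_sum of_nat N * 0) UNIV"
      by simp
    thus ?thesis using N by (subst (asm) has_sum_cmult_right_iff) auto
  qed
  have "norm (u j) \<le> \<epsilon>" if eps: "\<epsilon> > 0" for \<epsilon>
  proof -
    obtain F where F: "finite F" and F2: "norm (sum (\<lambda>l. norm (u l)) F - infsum (\<lambda>l. norm (u l)) UNIV) \<le> \<epsilon>"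
      using infsum_finite_approximation[OF an, of \<epsilon>] eps by (auto simp: dist_norm)
    define G where "G = insert j F"
    have G: "finite G" "j \<in> G" using F by (auto simp: G_def)
    have "sum (\<lambda>l. norm (u l)) F \<le> sum (\<lambda>l. norm (u l)) G"
      by (rule sum_mono2) (use G in \<open>auto simp: G_def\<close>)
    hence G2: "infsum (\<lambda>l. norm (u l)) UNIV - sum (\<lambda>l. norm (u l)) G \<le> \<epsilon>"
      using F2 by auto
    have tail: "infsum (\<lambda>l. norm (u l)) (- G) \<le> \<epsilon>"
      using G2 infsum_Un_disjoint[of "\<lambda>l. norm (u l)" G "-G"] summable_on_subset_banach[OF an] G
      by auto
    define N where "N = Suc (nat (Max ((\<lambda>l. \<bar>l - j\<bar>) ` G)))"
    have N: "l = j" if "l \<in> G" "int N dvd (l - j)" for l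
    proof (rule ccontr)
      assume "l \<noteq> j"
      hence "int N \<le> \<bar>l - j\<bar>" using that by (intro zdvd_imp_le) auto
      moreover have "\<bar>l - j\<bar> \<le> Max ((\<lambda>l. \<bar>l - j\<bar>) ` G)" using G that by (intro Max_ge) auto
      ultimately show False unfolding N_def by linarith
    qed
    define v' where "v' l = (if int N dvd (l - j) then u l else 0)" for l
    have v0: "(v' has_sum 0) UNIV" using v[of N] by (simp add: v'_def[abs_def] N_def)
    have "infsum v' UNIV = infsum v' G + infsum v' (-G)"
      using infsum_Un_disjoint[of v' G "-G"] G summable_on_subset_banach[OF has_sum_imp_summable[OF v0]] by auto
    moreover have "infsum v' G = (\<Sum>l\<in>G. if l = j then u j else 0)"
      unfolding infsum_finite[OF G(1)] by (rule sum.cong) (use N in \<open>auto simp: v'_def\<close>)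
    ultimately have "u j = - infsum v' (-G)"
      using v0 G by (simp add: infsumI eq_neg_iff_add_eq_0)
    hence "norm (u j) = norm (infsum v' (-G))" by simp
    also have "\<dots> \<le> infsum (\<lambda>l. norm (u l)) (-G)"
      by (rule norm_infsum_le[OF has_sum_infsum has_sum_infsum])
         (auto intro: summable_on_subset_banach[OF has_sum_imp_summable[OF v0]]
            summable_on_subset_banach[OF an], simp add: v'_def)
    finally show ?thesis using tail by simp
  qed
  hence "u j = 0" by (metis field_le_epsilon add_0 norm_le_zero_iff)
  thus ?thesis using r by (simp add: u_def)
qed

lemma laurent_unique:
  fixes c d :: "int \<Rightarrow> complex"
  assumes "r > 0" and "\<And>z. norm z = r \<Longrightarrow> ((\<lambda>l. c l * z powi l) has_sum g z) UNIV"
     and "\<And>z. norm z = r \<Longrightarrow> ((\<lambda>l. d l * z powi l) has_sum g z) UNIV"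
  shows "c = d"
proof
  fix j
  have "c j - d j = 0"
  proof (rule laurent_coeffs_zero[OF assms(1)])
    fix z :: complex assume z: "norm z = r"
    show "((\<lambda>l. (c l - d l) * z powi l) has_sum 0) UNIV"
      using has_sum_diff[OF assms(2,3)[OF z]] by (simp add: algebra_simps)
  qed
  thus "c j = d j" by simp
qed

section \<open>The q-Pochhammer symbol\<close>

definition qpoch :: "complex \<Rightarrow> complex \<Rightarrow> complex" where
  "qpoch t w = (\<Prod>j. 1 - w * t ^ j)"

lemma convergent_prod_qpoch:
  fixes t w :: complex
  assumes "norm t < 1"
  shows "convergent_prod (\<lambda>j. 1 - w * t ^ j)"
proof -
  have "summable (\<lambda>i. norm (1 - w * t ^ i - 1))"
    using assms by (simp add: norm_mult norm_power summable_geometric summable_mult)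
  hence "abs_convergent_prod (\<lambda>i. 1 - w * t ^ i)"
    by (rule summable_imp_abs_convergent_prod)
  thus ?thesis by (rule abs_convergent_prod_imp_convergent_prod)
qed

lemma qpoch_shift:
  assumes "norm t < 1"
  shows "qpoch t w = (1 - w) * qpoch t (w * t)"
proof -
  have lim: "(\<lambda>n. \<Prod>i<n. 1 - v * t ^ i) \<longlonglongrightarrow> qpoch t v" for v
    using convergent_prod_LIMSEQ[OF convergent_prod_qpoch[OF assms, of v]]
    unfolding qpoch_def LIMSEQ_lessThan_iff_atMost by simp
  have "(\<lambda>n. \<Prod>i<Suc n. 1 - w * t ^ i) \<longlonglongrightarrow> qpoch t w"
    using lim[of w] by (rule LIMSEQ_Suc)
  moreover have "(\<Prod>i<Suc n. 1 - w * t ^ i) = (1 - w) * (\<Prod>i<n. 1 - w * t * t ^ i)" for n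
    by (subst prod.lessThan_Suc_shift) (simp add: mult_ac)
  moreover have "(\<lambda>n. (1 - w) * (\<Prod>i<n. 1 - w * t * t ^ i)) \<longlonglongrightarrow> (1 - w) * qpoch t (w * t)"
    by (intro tendsto_intros lim)
  ultimately show ?thesis using LIMSEQ_unique by auto
qed

lemma qpoch_nonzero:
  assumes "norm t < 1" "norm w < 1"
  shows "qpoch t w \<noteq> 0"
  unfolding qpoch_def
proof (rule prodinf_nonzero[OF convergent_prod_qpoch[OF assms(1)]])
  fix i
  have "norm (w * t ^ i) \<le> norm w * 1"
    unfolding norm_mult norm_power
    by (rule mult_left_mono) (use assms in \<open>auto intro: power_le_one\<close>)
  also have "\<dots> < 1" using assms by simp
  finally have "norm (w * t ^ i) < 1" .
  thus "1 - w * t ^ i \<noteq> 0" by auto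
qed

lemma qpoch_holomorphic:
  assumes t: "norm t < 1"
  shows "qpoch t holomorphic_on UNIV"
proof (rule holomorphic_uniform_sequence[where f = "\<lambda>n w. \<Prod>i<n. 1 - w * t ^ i"])
  fix x :: complex
  have "uniformly_convergent_on (cball x 1) (\<lambda>n w. \<Prod>i<n. 1 - w * t ^ i)"
  proof (rule uniformly_convergent_on_prod')
    show "uniformly_convergent_on (cball x 1) (\<lambda>N w. \<Sum>n<N. norm (1 - w * t ^ n - 1))"
    proof (rule Weierstrass_m_test')
      show "summable (\<lambda>n. (norm x + 1) * norm t ^ n)"
        using t by (intro summable_mult summable_geometric) auto
      fix n w assume "w \<in> cball x 1"
      hence "norm w \<le> norm x + 1" 
        using norm_triangle_ineq2[of w x] by (simp add: dist_norm norm_minus_commute)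
      thus "norm (norm (1 - w * t ^ n - 1)) \<le> (norm x + 1) * norm t ^ n"
        by (simp add: norm_mult norm_power mult_right_mono)
    qed
  qed (auto intro!: continuous_intros)
  then obtain l where l: "uniform_limit (cball x 1) (\<lambda>n w. \<Prod>i<n. 1 - w * t ^ i) l sequentially"
    by (auto simp: uniformly_convergent_on_def)
  have "l w = qpoch t w" if "w \<in> cball x 1" for w
  proof -
    have "(\<lambda>n. \<Prod>i<n. 1 - w * t ^ i) \<longlonglongrightarrow> l w" using tendsto_uniform_limitI[OF l that] .
    moreover have "(\<lambda>n. \<Prod>i<n. 1 - w * t ^ i) \<longlonglongrightarrow> qpoch t w"
      using convergent_prod_LIMSEQ[OF convergent_prod_qpoch[OF t, of w]]
      unfolding qpoch_def LIMSEQ_lessThan_iff_atMost by simp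
    ultimately show ?thesis by (rule LIMSEQ_unique)
  qed
  hence "uniform_limit (cball x 1) (\<lambda>n w. \<Prod>i<n. 1 - w * t ^ i) (qpoch t) sequentially"
    by (intro uniform_limit_cong'[THEN iffD1, OF _ _ l]) auto
  thus "\<exists>d>0. cball x d \<subseteq> UNIV \<and> uniform_limit (cball x d) (\<lambda>n w. \<Prod>i<n. 1 - w * t ^ i) (qpoch t) sequentially"
    by (intro exI[of _ 1]) auto
qed (auto intro!: holomorphic_intros)

section \<open>Expansions around a double pole\<close>

lemma has_sum_power_series:
  fixes c :: "nat \<Rightarrow> complex"
  assumes sums: "\<And>x. norm x < r \<Longrightarrow> (\<lambda>n. c n * x ^ n) sums h x" and x: "norm x < r"
  shows "((\<lambda>n. c n * x ^ n) has_sum h x) UNIV"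
proof (rule norm_summable_imp_has_sum)
  define y where "y = complex_of_real ((norm x + r) / 2)"
  have "0 \<le> (norm x + r) / 2" using order_trans[OF norm_ge_zero less_imp_le[OF x]] by simp
  hence y: "norm y = (norm x + r) / 2" unfolding y_def norm_of_real by simp
  have "summable (\<lambda>n. c n * y ^ n)"
    using sums[of y] x y by (auto simp: sums_iff)
  thus "summable (\<lambda>n. norm (c n * x ^ n))"
    by (rule powser_insidea) (use x y in simp)
qed (rule sums[OF x])

lemma has_sum_nat_to_int:
  fixes f :: "int \<Rightarrow> complex"
  assumes "((\<lambda>n. f (int n)) has_sum s) UNIV"
  shows "((\<lambda>l. if l \<ge> 0 then f l else 0) has_sum s) UNIV"
proof -
  have "(f has_sum s) {0..}"
    using assms by (subst has_sum_reindex_bij_witness[where i = int and j = nat and T = UNIV and h = "\<lambda>n. f (int n)" and s' = s]) auto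
  thus ?thesis by (subst has_sum_cong_neutral[where T = "{0..}" and g = f]) auto
qed

lemma has_sum_double_pole_inner:
  fixes a b x :: complex
  assumes "norm x < 1"
  shows "((\<lambda>l. (if l \<ge> 0 then a * of_int l + b else 0) * x powi l) has_sum
           (a * x / (1 - x)\<^sup>2 + b / (1 - x))) UNIV"
proof -
  have "(\<lambda>n. (a * of_nat n + b) * y ^ n) sums (a * y / (1 - y)\<^sup>2 + b / (1 - y))" if y: "norm y < 1" for y
  proof -
    have "(\<lambda>n. a * (of_nat (Suc n) * y ^ n) + (b - a) * y ^ n) sums (a * (1 / (1 - y)\<^sup>2) + (b - a) * (1 / (1 - y)))"
      by (intro sums_add sums_mult geometric_deriv_sums geometric_sums y)
    moreover have "a * (1 / (1 - y)\<^sup>2) + (b - a) * (1 / (1 - y)) = a * y / (1 - y)\<^sup>2 + b / (1 - y)"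
      using y by (auto simp: divide_simps power2_eq_square) (simp add: algebra_simps)?
    ultimately show ?thesis by (simp add: algebra_simps)
  qed
  from has_sum_power_series[OF this assms]
  have "((\<lambda>n. (\<lambda>l. (a * of_int l + b) * x powi l) (int n)) has_sum (a * x / (1 - x)\<^sup>2 + b / (1 - x))) UNIV"
    by simp
  from has_sum_nat_to_int[OF this] show ?thesis
    by (rule has_sum_cong[THEN iffD1, rotated]) auto
qed

lemma has_sum_double_pole_outer:
  fixes a b x :: complex
  assumes "norm x > 1"
  shows "((\<lambda>l. (if l \<ge> 0 then 0 else - (a * of_int l + b)) * x powi l) has_sum
           (a * x / (1 - x)\<^sup>2 + b / (1 - x))) UNIV"
proof -
  define y where "y = 1 / x"
  have [simp]: "x \<noteq> 0" "x \<noteq> 1" using assms by auto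
  have y: "norm y < 1" using assms by (simp add: y_def norm_divide)
  have "((\<lambda>l. y * ((if l \<ge> 0 then a * of_int l + (a - b) else 0) * y powi l)) has_sum
           y * (a * y / (1 - y)\<^sup>2 + (a - b) / (1 - y))) UNIV"
    by (intro has_sum_cmult_right has_sum_double_pole_inner y)
  moreover have "y * (a * y / (1 - y)\<^sup>2 + (a - b) / (1 - y)) = a * x / (1 - x)\<^sup>2 + b / (1 - x)"
  proof -
    have "1 - y = (x - 1) / x" by (simp add: y_def field_simps)
    hence "y * (a * y / (1 - y)\<^sup>2 + (a - b) / (1 - y)) = 1 / x * (a / x / ((x - 1) / x)\<^sup>2 + (a - b) / ((x - 1) / x))"
      by (simp add: y_def)
    also have "\<dots> = a / (x - 1)\<^sup>2 + (a - b) / (x - 1)"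
      by (simp add: power_divide power2_eq_square field_simps)
    also have "\<dots> = a * x / (1 - x)\<^sup>2 + b / (1 - x)"
      by (simp add: divide_simps power2_eq_square) (simp add: algebra_simps)
    finally show ?thesis .
  qed
  ultimately have "((\<lambda>l. y * ((if l \<ge> 0 then a * of_int l + (a - b) else 0) * y powi l)) has_sum
           (a * x / (1 - x)\<^sup>2 + b / (1 - x))) UNIV" by simp
  moreover have "y * ((if - 1 - l \<ge> 0 then a * of_int (- 1 - l) + (a - b) else 0) * y powi (- 1 - l)) =
      (if l \<ge> 0 then 0 else - (a * of_int l + b)) * x powi l" for l
  proof -
    have "y * (d * y powi (-1 - l)) = d * x powi l" for d
      by (simp add: y_def power_int_diff power_int_minus power_int_one_over field_simps)
    thus ?thesis by (simp only:) (simp add: algebra_simps)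
  qed
  ultimately show ?thesis
    by (subst has_sum_reindex_bij_witness[where i = "\<lambda>l. - 1 - l" and j = "\<lambda>l. - 1 - l" and T = UNIV and s' = "a * x / (1 - x)\<^sup>2 + b / (1 - x)"
     and h = "\<lambda>l. y * ((if l \<ge> 0 then a * of_int l + (a - b) else 0) * y powi l)"]) auto
qed

lemma double_pole_expansions:
  fixes g :: "complex \<Rightarrow> complex"
  assumes g: "g holomorphic_on ball 0 R" and R: "R > 1"
  obtains f0 f1 a b where
    "\<And>x. norm x < 1 \<Longrightarrow> ((\<lambda>l. f0 l * x powi l) has_sum g x / (1 - x)\<^sup>2) UNIV"
    "\<And>x. 1 < norm x \<Longrightarrow> norm x < R \<Longrightarrow> ((\<lambda>l. f1 l * x powi l) has_sum g x / (1 - x)\<^sup>2) UNIV"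
    "\<And>l. f0 l - f1 l = a * of_int l + b"
proof -
  define g1 where "g1 x = (if x = 1 then deriv g 1 else (g x - g 1) / (x - 1))" for x
  define g2 where "g2 x = (if x = 1 then deriv g1 1 else (g1 x - g1 1) / (x - 1))" for x
  have "g1 holomorphic_on ball 0 R"
    unfolding g1_def[abs_def] by (rule pole_lemma_open[OF g]) auto
  hence g2: "g2 holomorphic_on ball 0 R"
    unfolding g2_def[abs_def] by (rule pole_lemma_open) auto
  define c where "c l = (if l \<ge> 0 then (deriv ^^ nat l) g2 0 / fact (nat l) else 0)" for l :: int
  have c: "((\<lambda>l. c l * x powi l) has_sum g2 x) UNIV" if x: "norm x < R" for x
  proof -
    have "((\<lambda>n. (\<lambda>l. c l * x powi l) (int n)) has_sum g2 x) UNIV"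
      using has_sum_power_series[of R "\<lambda>n. (deriv ^^ n) g2 0 / fact n" g2 x] holomorphic_power_series[OF g2] x
      by (simp add: c_def)
    from has_sum_nat_to_int[OF this] show ?thesis
      by (rule has_sum_cong[THEN iffD1, rotated]) (auto simp: c_def)
  qed
  define a b where "a = g 1" and "b = g 1 - g1 1"
  have eq: "a * x / (1 - x)\<^sup>2 + b / (1 - x) + g2 x = g x / (1 - x)\<^sup>2" if "x \<noteq> 1" for x
  proof -
    have "g x = g 1 + (x - 1) * (g1 1 + (x - 1) * g2 x)"
      using that by (simp add: g2_def) (simp add: g1_def)
    thus ?thesis using that unfolding a_def b_def
      by (simp add: divide_simps power2_eq_square) (simp add: algebra_simps)
  qed
  show ?thesis
  proof (rule that)
    fix x :: complex assume x: "norm x < 1"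
    hence "x \<noteq> 1" by auto
    have "((\<lambda>l. (if l \<ge> 0 then a * of_int l + b else 0) * x powi l + c l * x powi l) has_sum
      (a * x / (1 - x)\<^sup>2 + b / (1 - x) + g2 x)) UNIV"
      by (intro has_sum_add has_sum_double_pole_inner c) (use x R in auto)
    thus "((\<lambda>l. ((if l \<ge> 0 then a * of_int l + b else 0) + c l) * x powi l) has_sum g x / (1 - x)\<^sup>2) UNIV"
      using eq[OF \<open>x \<noteq> 1\<close>] by (simp add: distrib_right)
  next
    fix x :: complex assume x: "1 < norm x" "norm x < R"
    hence "x \<noteq> 1" by auto
    have "((\<lambda>l. (if l \<ge> 0 then 0 else - (a * of_int l + b)) * x powi l + c l * x powi l) has_sum
      (a * x / (1 - x)\<^sup>2 + b / (1 - x) + g2 x)) UNIV"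
      by (intro has_sum_add has_sum_double_pole_outer c) (use x R in auto)
    thus "((\<lambda>l. ((if l \<ge> 0 then 0 else - (a * of_int l + b)) + c l) * x powi l) has_sum g x / (1 - x)\<^sup>2) UNIV"
      using eq[OF \<open>x \<noteq> 1\<close>] by (simp add: distrib_right)
  next
    fix l :: int
    show "((if l \<ge> 0 then a * of_int l + b else 0) + c l) - ((if l \<ge> 0 then 0 else - (a * of_int l + b)) + c l) = a * of_int l + b"
      by simp
  qed
qed

lemma has_sum_square_powi:
  fixes f :: "int \<Rightarrow> complex"
  assumes "((\<lambda>l. f l * (z\<^sup>2) powi l) has_sum s) UNIV"
  shows "((\<lambda>l. (if even l then f (l div 2) else 0) * z powi l) has_sum s) UNIV"
proof -
  have "((\<lambda>l. f (l div 2) * z powi l) has_sum s) {l. even l}"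
    using assms
    by (subst has_sum_reindex_bij_witness[where i = "\<lambda>l. 2 * l" and j = "\<lambda>l. l div 2" and T = UNIV and s' = s
      and h = "\<lambda>l. f l * (z\<^sup>2) powi l"]) (auto simp: power_int_mult)
  thus ?thesis by (subst has_sum_cong_neutral[where T = "{l. even l}" and g = "\<lambda>l. f (l div 2) * z powi l"]) auto
qed

lemma laurent_coeff_on_eqI:
  assumes "\<And>z. z \<in> A \<Longrightarrow> ((\<lambda>l. c l * z powi l) has_sum g z) UNIV"
    and "r > 0" and "sphere 0 r \<subseteq> A"
  shows "laurent_coeff_on g A = c"
  unfolding laurent_coeff_on_def
proof (rule the_equality)
  fix d assume d: "\<forall>z\<in>A. ((\<lambda>l. d l * z powi l) has_sum g z) UNIV"
  show "d = c"
    by (rule laurent_unique[OF assms(2), where g = g]) (use d assms in auto)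
qed (use assms in auto)

section \<open>The functional equation of the structure function\<close>

lemma has_sum_convolution_diff:
  fixes u v u' v' :: "int \<Rightarrow> complex"
  assumes r: "r > 0"
    and u: "\<And>x. norm x = r \<Longrightarrow> ((\<lambda>l. u l * x powi l) has_sum U x) UNIV"
    and v: "\<And>x. norm x = r \<Longrightarrow> ((\<lambda>l. v l * x powi l) has_sum V x) UNIV"
    and u': "\<And>x. norm x = r \<Longrightarrow> ((\<lambda>l. u' l * x powi l) has_sum U' x) UNIV"
    and v': "\<And>x. norm x = r \<Longrightarrow> ((\<lambda>l. v' l * x powi l) has_sum V' x) UNIV"
    and eq: "\<And>x. norm x = r \<Longrightarrow> U x * V x = U' x * V' x"
  shows "((\<lambda>i. u i * v (m - i) - u' i * v' (m - i)) has_sum 0) UNIV"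
proof -
  have conv: "((\<lambda>m. (\<Sum>\<^sub>\<infinity>i. a i * b (m - i)) * x powi m) has_sum s * t) UNIV \<and> (\<lambda>i. a i * b (m - i)) summable_on UNIV"
    if a: "((\<lambda>l. a l * x powi l) has_sum s) UNIV" and b: "((\<lambda>l. b l * x powi l) has_sum t) UNIV"
      and x: "norm x = r" for a b :: "int \<Rightarrow> complex" and x s t m
  proof -
    have x0: "x \<noteq> 0" using x r by auto
    have eq: "(a i * x powi i) * (b (k - i) * x powi (k - i)) = (a i * b (k - i)) * x powi k" for i k
      using x0 by (simp add: power_int_diff)
    note * = has_sum_int_convolution[OF a b, unfolded eq]
    have "(\<lambda>i. a i * b (m - i) * x powi m * inverse (x powi m)) summable_on UNIV"
      by (rule summable_on_cmult_left) (rule *(2))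
    moreover have "a i * b (m - i) * x powi m * inverse (x powi m) = a i * b (m - i)" for i
      using x0 by (simp only: mult.assoc right_inverse power_int_eq_0_iff simp_thms mult_1_right)
    ultimately have "(\<lambda>i. a i * b (m - i)) summable_on UNIV" by (simp only:)
    with *(1) show ?thesis by (simp add: infsum_cmult_left')
  qed
  have "(\<lambda>m. \<Sum>\<^sub>\<infinity>i. u i * v (m - i)) = (\<lambda>m. \<Sum>\<^sub>\<infinity>i. u' i * v' (m - i))"
    by (rule laurent_unique[OF r, where g = "\<lambda>x. U x * V x"])
       (use conv[OF u v] conv[OF u' v'] eq in auto)
  hence "(\<Sum>\<^sub>\<infinity>i. u i * v (m - i)) = (\<Sum>\<^sub>\<infinity>i. u' i * v' (m - i))"
    by (rule fun_cong)
  moreover have "norm (complex_of_real r) = r" using r by simp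
  hence "(\<lambda>i. u i * v (m - i)) summable_on UNIV" "(\<lambda>i. u' i * v' (m - i)) summable_on UNIV"
    using conv[OF u v] conv[OF u' v'] by blast+
  note has_sum_diff[OF this[THEN has_sum_infsum]]
  ultimately show ?thesis by simp
qed

lemma has_sum_scale_powi:
  fixes f :: "int \<Rightarrow> complex"
  assumes "((\<lambda>l. f l * (w * x) powi l) has_sum s) UNIV"
  shows "((\<lambda>l. (f l * w powi l) * x powi l) has_sum s) UNIV"
  using assms by (simp add: power_int_mult_distrib mult_ac)

lemma has_sum_reflect_powi:
  fixes f :: "int \<Rightarrow> complex"
  assumes "((\<lambda>l. f l * (inverse x) powi l) has_sum s) UNIV"
  shows "((\<lambda>l. f (- l) * x powi l) has_sum s) UNIV"
proof -
  have "inverse x powi (- l) = x powi l" for l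
    by (simp only: power_int_inverse power_int_minus inverse_inverse_eq)
  thus ?thesis using assms
    by (subst has_sum_reindex_bij_witness[where i = uminus and j = uminus and T = UNIV and s' = s
      and h = "\<lambda>l. f l * (inverse x) powi l"]) auto
qed

definition qnum :: "complex \<Rightarrow> complex \<Rightarrow> complex \<Rightarrow> complex" where
  "qnum p q x = (qpoch (q^4) (x * p) * qpoch (q^4) (x * q\<^sup>2 / p) /
     (qpoch (q^4) (x * p * q\<^sup>2) * qpoch (q^4) (x * q^4 / p)))\<^sup>2"

lemma qvir_fun_eq_qnum:
  assumes q: "norm q < 1"
  shows "qvir_fun p q z = qnum p q (z\<^sup>2) / (1 - z\<^sup>2)\<^sup>2"
proof -
  have t: "norm (q ^ 4) < 1" using q by (simp add: norm_power power_less_one_iff)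
  note c = convergent_prod_qpoch[OF t]
  have "(\<Prod>j. ((1 - z\<^sup>2 * p * q ^ (4 * j))\<^sup>2 * (1 - z\<^sup>2 * inverse p * q ^ (4 * j + 2))\<^sup>2) /
           ((1 - z\<^sup>2 * p * q ^ (4 * j + 2))\<^sup>2 * (1 - z\<^sup>2 * inverse p * q ^ (4 * j + 4))\<^sup>2))
      = (\<Prod>j. ((1 - (z\<^sup>2 * p) * (q^4)^j) * (1 - (z\<^sup>2 * q\<^sup>2 / p) * (q^4)^j) /
           ((1 - (z\<^sup>2 * p * q\<^sup>2) * (q^4)^j) * (1 - (z\<^sup>2 * q^4 / p) * (q^4)^j)))\<^sup>2)"
  proof (rule prodinf_cong)
    fix j
    have 1: "z\<^sup>2 * p * q ^ (4 * j) = (z\<^sup>2 * p) * (q^4)^j"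
            "z\<^sup>2 * inverse p * q ^ (4 * j + 2) = (z\<^sup>2 * q\<^sup>2 / p) * (q^4)^j"
            "z\<^sup>2 * p * q ^ (4 * j + 2) = (z\<^sup>2 * p * q\<^sup>2) * (q^4)^j"
            "z\<^sup>2 * inverse p * q ^ (4 * j + 4) = (z\<^sup>2 * q^4 / p) * (q^4)^j"
      unfolding power_add power_mult divide_inverse by (simp_all add: power2_eq_square mult_ac)
    show "((1 - z\<^sup>2 * p * q ^ (4 * j))\<^sup>2 * (1 - z\<^sup>2 * inverse p * q ^ (4 * j + 2))\<^sup>2) /
           ((1 - z\<^sup>2 * p * q ^ (4 * j + 2))\<^sup>2 * (1 - z\<^sup>2 * inverse p * q ^ (4 * j + 4))\<^sup>2)
       = ((1 - (z\<^sup>2 * p) * (q^4)^j) * (1 - (z\<^sup>2 * q\<^sup>2 / p) * (q^4)^j) /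
           ((1 - (z\<^sup>2 * p * q\<^sup>2) * (q^4)^j) * (1 - (z\<^sup>2 * q^4 / p) * (q^4)^j)))\<^sup>2"
      unfolding 1 power_divide power_mult_distrib ..
  qed
  also have "\<dots> = (\<Prod>j. (1 - (z\<^sup>2 * p) * (q^4)^j) * (1 - (z\<^sup>2 * q\<^sup>2 / p) * (q^4)^j) /
           ((1 - (z\<^sup>2 * p * q\<^sup>2) * (q^4)^j) * (1 - (z\<^sup>2 * q^4 / p) * (q^4)^j)))\<^sup>2"
    by (intro prodinf_power convergent_prod_mult convergent_prod_divide c)
  also have "\<dots> = qnum p q (z\<^sup>2)"
    unfolding qnum_def qpoch_def
    by (simp only: prodinf_mult prodinf_divide convergent_prod_mult c)
  finally show ?thesis unfolding qvir_fun_def by simp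
qed

context
  fixes p q :: complex
  assumes q0: "0 < norm q" and qp: "norm q \<le> norm p" and p1: "norm p < 1"
begin

lemma pq_bounds:
  "p \<noteq> 0" "q \<noteq> 0" "norm q < 1" "norm p > 0" "(norm q)\<^sup>2 < 1" "norm p * (norm q)\<^sup>2 < (norm q)\<^sup>2"
  "norm p * (norm q)\<^sup>2 < 1"
proof -
  show "p \<noteq> 0" "q \<noteq> 0" "norm q < 1" "norm p > 0" using q0 qp p1 by auto
  thus "(norm q)\<^sup>2 < 1" by (simp add: power_less_one_iff)
  moreover show "norm p * (norm q)\<^sup>2 < (norm q)\<^sup>2"
    using p1 q0 mult_strict_right_mono[of "norm p" 1 "(norm q)\<^sup>2"] by auto
  ultimately show "norm p * (norm q)\<^sup>2 < 1" by linarith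
qed

lemma norm_scale: "norm (inverse (q\<^sup>2) * x) = norm x / (norm q)\<^sup>2"
  by (simp add: norm_mult norm_inverse norm_power norm_divide field_simps)

lemma qpoch_denominators_nonzero:
  assumes x: "norm x < 1 / (norm p * (norm q)\<^sup>2)"
  shows "qpoch (q^4) (x * p * q\<^sup>2) \<noteq> 0" "qpoch (q^4) (x * q^4 / p) \<noteq> 0"
proof -
  have t: "norm (q ^ 4) < 1" using qp p1 by (simp add: norm_power power_less_one_iff)
  have p0: "norm p > 0" using q0 qp by linarith
  have 1: "norm x * (norm p * (norm q)\<^sup>2) < 1"
    using x p0 q0 by (simp add: field_simps)
  thus "qpoch (q^4) (x * p * q\<^sup>2) \<noteq> 0"
    by (intro qpoch_nonzero t) (simp add: norm_mult norm_power mult_ac)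
  have "norm x * norm q ^ 4 = norm x * (norm q)\<^sup>2 * (norm q)\<^sup>2" 
    by (simp add: power4_eq_xxxx power2_eq_square)
  also have "\<dots> \<le> norm x * (norm q)\<^sup>2 * (norm p)\<^sup>2"
    using qp by (intro mult_left_mono power_mono) auto
  also have "\<dots> = (norm x * (norm p * (norm q)\<^sup>2)) * norm p"
    by (simp add: power2_eq_square)
  also have "\<dots> < 1 * norm p"
    using 1 p0 by (rule mult_strict_right_mono)
  finally show "qpoch (q^4) (x * q^4 / p) \<noteq> 0"
    using p0 by (intro qpoch_nonzero t) (simp add: norm_mult norm_power norm_divide field_simps)
qed

lemma qnum_holomorphic: "qnum p q holomorphic_on ball 0 (1 / (norm p * (norm q)\<^sup>2))"
proof -
  have t: "norm (q ^ 4) < 1" using qp p1 by (simp add: norm_power power_less_one_iff)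
  have *: "(\<lambda>x. qpoch (q^4) (f x)) holomorphic_on A" if "f holomorphic_on A" for f A
    using holomorphic_on_compose[OF that holomorphic_on_subset[OF qpoch_holomorphic[OF t]]]
    by (simp add: o_def)
  show ?thesis unfolding qnum_def
    using qpoch_denominators_nonzero q0 qp
    by (intro holomorphic_intros * ) auto
qed

lemma qnum_functional_equation:
  assumes x: "norm x < 1 / (norm p * (norm q)\<^sup>2)"
  shows "qnum p q x * qnum p q (q\<^sup>2 * x) = ((1 - x * p) * (1 - x * q\<^sup>2 / p))\<^sup>2"
proof -
  have t: "norm (q ^ 4) < 1" using qp p1 by (simp add: norm_power power_less_one_iff)
  have "norm (q\<^sup>2 * x) \<le> 1 * norm x"
    unfolding norm_mult norm_power using qp p1 by (intro mult_right_mono power_le_one) auto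
  hence x': "norm (q\<^sup>2 * x) < 1 / (norm p * (norm q)\<^sup>2)" using x by simp
  have s: "qpoch (q^4) (x * p) = (1 - x * p) * qpoch (q^4) (q\<^sup>2 * x * p * q\<^sup>2)"
          "qpoch (q^4) (x * q\<^sup>2 / p) = (1 - x * q\<^sup>2 / p) * qpoch (q^4) (q\<^sup>2 * x * q ^ 4 / p)"
  proof -
    have "x * p * q^4 = q\<^sup>2 * x * p * q\<^sup>2" "x * q\<^sup>2 / p * q^4 = q\<^sup>2 * x * q ^ 4 / p"
      by (simp_all add: power4_eq_xxxx power2_eq_square)
    thus "qpoch (q^4) (x * p) = (1 - x * p) * qpoch (q^4) (q\<^sup>2 * x * p * q\<^sup>2)"
      "qpoch (q^4) (x * q\<^sup>2 / p) = (1 - x * q\<^sup>2 / p) * qpoch (q^4) (q\<^sup>2 * x * q ^ 4 / p)"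
      using qpoch_shift[OF t, of "x * p"] qpoch_shift[OF t, of "x * q\<^sup>2 / p"] by (simp_all only:)
  qed
  have e: "q\<^sup>2 * x * p = x * p * q\<^sup>2" "q\<^sup>2 * x * q\<^sup>2 / p = x * q ^ 4 / p"
    by (simp_all add: power4_eq_xxxx power2_eq_square)
  define A B C D where "A = qpoch (q^4) (x * p * q\<^sup>2)" and "B = qpoch (q^4) (x * q^4 / p)"
    and "C = qpoch (q^4) (q\<^sup>2 * x * p * q\<^sup>2)" and "D = qpoch (q^4) (q\<^sup>2 * x * q^4 / p)"
  have nz: "A \<noteq> 0" "B \<noteq> 0" "C \<noteq> 0" "D \<noteq> 0"
    using qpoch_denominators_nonzero[OF x] qpoch_denominators_nonzero[OF x']
    by (auto simp: A_def B_def C_def D_def)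
  have "qnum p q x = ((1 - x * p) * C * ((1 - x * q\<^sup>2 / p) * D) / (A * B))\<^sup>2"
    unfolding qnum_def s A_def B_def C_def D_def ..
  moreover have "qnum p q (q\<^sup>2 * x) = (A * B / (C * D))\<^sup>2"
    unfolding qnum_def e A_def B_def C_def D_def ..
  moreover have "(1 - x * p) * C * ((1 - x * q\<^sup>2 / p) * D) / (A * B) * (A * B / (C * D)) = (1 - x * p) * (1 - x * q\<^sup>2 / p)"
    using nz by simp
  ultimately show ?thesis by (metis power_mult_distrib)
qed

lemma qnum_functional_equation_inverse:
  assumes x: "x \<noteq> 0" "norm x < 1 / norm p" "norm p * (norm q)\<^sup>2 < norm x"
  shows "qnum p q (inverse (q\<^sup>2) * x) / (1 - inverse (q\<^sup>2) * x)\<^sup>2 * (qnum p q x / (1 - x)\<^sup>2) =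
         qnum p q (q\<^sup>2 * inverse x) / (1 - q\<^sup>2 * inverse x)\<^sup>2 * (qnum p q (inverse x) / (1 - inverse x)\<^sup>2)"
proof -
  note b = pq_bounds
  have 1: "norm (inverse (q\<^sup>2) * x) < 1 / (norm p * (norm q)\<^sup>2)"
    using x(2) b unfolding norm_scale by (simp add: field_simps)
  have 2: "norm (inverse x) < 1 / (norm p * (norm q)\<^sup>2)"
    using x b unfolding norm_inverse by (simp add: field_simps)
  have e: "q\<^sup>2 * (inverse (q\<^sup>2) * x) = x" using b by simp
  note F = qnum_functional_equation[OF 1, unfolded e] qnum_functional_equation[OF 2]
  have G: "(1 - inverse (q\<^sup>2) * x * p) * (1 - inverse (q\<^sup>2) * x * q\<^sup>2 / p) / ((1 - inverse (q\<^sup>2) * x) * (1 - x)) =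
      (1 - inverse x * p) * (1 - inverse x * q\<^sup>2 / p) / ((1 - q\<^sup>2 * inverse x) * (1 - inverse x))"
  proof -
    have "(1 - inverse (q\<^sup>2) * x * p) * (1 - inverse (q\<^sup>2) * x * q\<^sup>2 / p) = (q\<^sup>2 - x * p) * (p - x) / (q\<^sup>2 * p)"
      using b by (simp add: field_simps)
    moreover have "(1 - inverse (q\<^sup>2) * x) * (1 - x) = (q\<^sup>2 - x) * (1 - x) / q\<^sup>2"
      using b by (simp add: field_simps)
    moreover have "(1 - inverse x * p) * (1 - inverse x * q\<^sup>2 / p) = (p - x) * (q\<^sup>2 - x * p) / (p * x\<^sup>2)"
      using b x by (simp add: field_simps power2_eq_square)
    moreover have "(1 - q\<^sup>2 * inverse x) * (1 - inverse x) = (q\<^sup>2 - x) * (1 - x) / x\<^sup>2"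
      using b x by (simp add: field_simps power2_eq_square)
    ultimately show ?thesis using b x by simp
  qed
  have "qnum p q (inverse (q\<^sup>2) * x) / (1 - inverse (q\<^sup>2) * x)\<^sup>2 * (qnum p q x / (1 - x)\<^sup>2)
     = ((1 - inverse (q\<^sup>2) * x * p) * (1 - inverse (q\<^sup>2) * x * q\<^sup>2 / p) / ((1 - inverse (q\<^sup>2) * x) * (1 - x)))\<^sup>2"
    unfolding times_divide_times_eq F power_mult_distrib[symmetric] power_divide ..
  also have "\<dots> = qnum p q (inverse x) * qnum p q (q\<^sup>2 * inverse x) / ((1 - q\<^sup>2 * inverse x) * (1 - inverse x))\<^sup>2"
    unfolding G F power_divide ..
  finally show ?thesis by (simp add: power_mult_distrib mult_ac)
qed

context
  fixes f0 f1 :: "int \<Rightarrow> complex"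
  assumes f0: "\<And>x. norm x < 1 \<Longrightarrow> ((\<lambda>l. f0 l * x powi l) has_sum qnum p q x / (1 - x)\<^sup>2) UNIV"
    and f1: "\<And>x. 1 < norm x \<Longrightarrow> norm x < 1 / (norm p * (norm q)\<^sup>2) \<Longrightarrow>
               ((\<lambda>l. f1 l * x powi l) has_sum qnum p q x / (1 - x)\<^sup>2) UNIV"
begin

section \<open>The cocycle condition\<close>

lemma qvir_coeff_even: "qvir_coeff p q (2 * l) = (f0 l + f1 l) / 2"
proof -
  define S where "S = 1 / (sqrt (norm p) * norm q)"
  have S: "S\<^sup>2 = 1 / (norm p * (norm q)\<^sup>2)"
    using pq_bounds by (simp add: S_def power_divide power_mult_distrib)
  have S1: "S > 1"
  proof -
    have "S\<^sup>2 > 1\<^sup>2" unfolding S using pq_bounds q0 by (simp add: field_simps)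
    moreover have "S \<ge> 0" by (simp add: S_def)
    ultimately show ?thesis by (rule power_less_imp_less_base)
  qed
  define e where "e f l = (if even l then f (l div 2) else 0)" for f :: "int \<Rightarrow> complex" and l :: int
  have "laurent_coeff_on (qvir_fun p q) (ball 0 1) = e f0"
  proof (rule laurent_coeff_on_eqI)
    fix z :: complex assume "z \<in> ball 0 1"
    hence "norm (z\<^sup>2) < 1" by (simp add: norm_power power_less_one_iff)
    from has_sum_square_powi[OF f0[OF this]] show "((\<lambda>l. e f0 l * z powi l) has_sum qvir_fun p q z) UNIV"
      by (simp add: e_def qvir_fun_eq_qnum pq_bounds)
  next
    show "(1/2::real) > 0" "sphere (0::complex) (1/2) \<subseteq> ball 0 1" by auto
  qed
  moreover have "laurent_coeff_on (qvir_fun p q) (qvir_ring p q) = e f1"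
  proof (rule laurent_coeff_on_eqI)
    fix z :: complex assume "z \<in> qvir_ring p q"
    hence z: "1 < norm z" "norm z < S" by (auto simp: qvir_ring_def S_def)
    have "1 < norm (z\<^sup>2)" using z by (simp add: norm_power)
    moreover have "norm (z\<^sup>2) < S\<^sup>2"
      unfolding norm_power using z by (intro power_strict_mono) auto
    ultimately have "((\<lambda>l. f1 l * (z\<^sup>2) powi l) has_sum qnum p q (z\<^sup>2) / (1 - z\<^sup>2)\<^sup>2) UNIV"
      unfolding S by (rule f1)
    from has_sum_square_powi[OF this] show "((\<lambda>l. e f1 l * z powi l) has_sum qvir_fun p q z) UNIV"
      by (simp add: e_def qvir_fun_eq_qnum pq_bounds)
  next
    show "(1 + S) / 2 > 0" "sphere (0::complex) ((1 + S) / 2) \<subseteq> qvir_ring p q"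
      using S1 by (auto simp: qvir_ring_def simp flip: S_def)
  qed
  ultimately show ?thesis by (simp add: qvir_coeff_def e_def)
qed

lemma convolution_cancel_outer:
  "((\<lambda>i. (f1 i * f1 (m - i) - f0 (- i) * f0 (i - m)) * q powi (- 2 * i)) has_sum 0) UNIV"
proof -
  define r where "r = (1 + 1 / norm p) / 2"
  have r: "1 < r" "r < 1 / norm p" using p1 pq_bounds by (auto simp: r_def field_simps)
  have "((\<lambda>i. (f1 i * inverse (q\<^sup>2) powi i) * f1 (m - i) - (f0 (- i) * inverse (q\<^sup>2) powi i) * f0 (- (m - i))) has_sum 0) UNIV"
  proof (rule has_sum_convolution_diff)
    fix x :: complex assume x: "norm x = r"
    note b = pq_bounds
    have "norm (inverse (q\<^sup>2) * x) > 1"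
      using x r b unfolding norm_scale by (simp add: field_simps)
    moreover have "norm (inverse (q\<^sup>2) * x) < 1 / (norm p * (norm q)\<^sup>2)"
      using x r b unfolding norm_scale by (simp add: field_simps)
    ultimately show "((\<lambda>l. (f1 l * inverse (q\<^sup>2) powi l) * x powi l) has_sum
      qnum p q (inverse (q\<^sup>2) * x) / (1 - inverse (q\<^sup>2) * x)\<^sup>2) UNIV"
      by (intro has_sum_scale_powi f1)
    have "1 / norm p \<le> 1 / (norm p * (norm q)\<^sup>2)" using b by (intro divide_left_mono) auto
    thus "((\<lambda>l. f1 l * x powi l) has_sum qnum p q x / (1 - x)\<^sup>2) UNIV"
      by (intro f1) (use x r in auto)
    have x1: "norm (inverse x) < 1" using x r unfolding norm_inverse by (simp add: field_simps)
    thus "((\<lambda>l. f0 (- l) * x powi l) has_sum qnum p q (inverse x) / (1 - inverse x)\<^sup>2) UNIV"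
      by (intro has_sum_reflect_powi f0)
    have "norm (q\<^sup>2 * inverse x) < 1 * 1"
      unfolding norm_mult norm_power using x1 b by (intro mult_strict_mono) auto
    hence "((\<lambda>l. f0 l * (q\<^sup>2 * inverse x) powi l) has_sum qnum p q (q\<^sup>2 * inverse x) / (1 - q\<^sup>2 * inverse x)\<^sup>2) UNIV"
      by (intro f0) auto
    from has_sum_reflect_powi[OF has_sum_scale_powi[OF this]]
    show "((\<lambda>l. (f0 (- l) * inverse (q\<^sup>2) powi l) * x powi l) has_sum qnum p q (q\<^sup>2 * inverse x) / (1 - q\<^sup>2 * inverse x)\<^sup>2) UNIV"
      by (simp add: power_int_minus power_int_inverse)
    show "qnum p q (inverse (q\<^sup>2) * x) / (1 - inverse (q\<^sup>2) * x)\<^sup>2 * (qnum p q x / (1 - x)\<^sup>2) =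
         qnum p q (q\<^sup>2 * inverse x) / (1 - q\<^sup>2 * inverse x)\<^sup>2 * (qnum p q (inverse x) / (1 - inverse x)\<^sup>2)"
      by (rule qnum_functional_equation_inverse) (use x r b in auto)
  qed (use r in simp)
  moreover have "inverse (q\<^sup>2) powi i = q powi (- 2 * i)" for i
    by (simp add: power_int_inverse power_int_minus power_int_mult)
  ultimately show ?thesis by (simp add: algebra_simps)
qed

lemma convolution_cancel_inner:
  "((\<lambda>i. (f0 i * f0 (m - i) - f1 (- i) * f1 (i - m)) * q powi (- 2 * i)) has_sum 0) UNIV"
proof -
  define r where "r = (norm p + 1) / 2 * (norm q)\<^sup>2"
  note b = pq_bounds
  have r: "norm p * (norm q)\<^sup>2 < r" "r < (norm q)\<^sup>2" using p1 q0 by (auto simp: r_def)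
  have r0: "r > 0" using r b by (meson mult_pos_pos less_trans zero_less_power q0)
  have "((\<lambda>i. (f0 i * inverse (q\<^sup>2) powi i) * f0 (m - i) - (f1 (- i) * inverse (q\<^sup>2) powi i) * f1 (- (m - i))) has_sum 0) UNIV"
  proof (rule has_sum_convolution_diff[OF r0])
    fix x :: complex assume x: "norm x = r"
    have x0: "x \<noteq> 0" using x r0 by auto
    have x1: "norm x < 1" using x r b by linarith
    have "norm (inverse (q\<^sup>2) * x) < 1"
      using x r b unfolding norm_scale by (simp add: field_simps)
    thus "((\<lambda>l. (f0 l * inverse (q\<^sup>2) powi l) * x powi l) has_sum
      qnum p q (inverse (q\<^sup>2) * x) / (1 - inverse (q\<^sup>2) * x)\<^sup>2) UNIV"
      by (intro has_sum_scale_powi f0)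
    show "((\<lambda>l. f0 l * x powi l) has_sum qnum p q x / (1 - x)\<^sup>2) UNIV"
      by (intro f0 x1)
    have "1 < norm (q\<^sup>2 * inverse x)"
      using x r r0 unfolding norm_inverse norm_mult norm_power by (simp add: field_simps)
    moreover have "norm (q\<^sup>2 * inverse x) \<le> 1 * norm (inverse x)"
      unfolding norm_mult norm_power using b by (intro mult_right_mono) auto
    moreover have "norm (inverse x) < 1 / (norm p * (norm q)\<^sup>2)"
      using x r r0 b unfolding norm_inverse by (simp add: field_simps)
    ultimately have *: "1 < norm (q\<^sup>2 * inverse x)" "norm (q\<^sup>2 * inverse x) < 1 / (norm p * (norm q)\<^sup>2)"
        "1 < norm (inverse x)" "norm (inverse x) < 1 / (norm p * (norm q)\<^sup>2)" by linarith+
    from *(3,4) show "((\<lambda>l. f1 (- l) * x powi l) has_sum qnum p q (inverse x) / (1 - inverse x)\<^sup>2) UNIV"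
      by (intro has_sum_reflect_powi f1)
    from has_sum_reflect_powi[OF has_sum_scale_powi[OF f1[OF *(1,2)]]]
    show "((\<lambda>l. (f1 (- l) * inverse (q\<^sup>2) powi l) * x powi l) has_sum qnum p q (q\<^sup>2 * inverse x) / (1 - q\<^sup>2 * inverse x)\<^sup>2) UNIV"
      by (simp add: power_int_minus power_int_inverse)
    have "1 < 1 / norm p" using p1 b by simp
    thus "qnum p q (inverse (q\<^sup>2) * x) / (1 - inverse (q\<^sup>2) * x)\<^sup>2 * (qnum p q x / (1 - x)\<^sup>2) =
         qnum p q (q\<^sup>2 * inverse x) / (1 - q\<^sup>2 * inverse x)\<^sup>2 * (qnum p q (inverse x) / (1 - inverse x)\<^sup>2)"
      by (intro qnum_functional_equation_inverse) (use x0 x x1 r in auto)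
  qed
  moreover have "inverse (q\<^sup>2) powi i = q powi (- 2 * i)" for i
    by (simp add: power_int_inverse power_int_minus power_int_mult)
  ultimately show ?thesis by (simp add: algebra_simps)
qed

context
  fixes a b :: complex
  assumes jump: "\<And>l. f0 l - f1 l = a * of_int l + b"
begin

text \<open>The last summand cancels the common limit of the difference of products for
  \<open>i\<close> tending to plus or minus infinity.\<close>
definition pair_term :: "int \<Rightarrow> int \<Rightarrow> complex" where
  "pair_term m i = qvir_coeff p q (2 * i) * qvir_coeff p q (2 * (m - i)) -
     qvir_coeff p q (2 * - i) * qvir_coeff p q (2 * (i - m)) + a * b * of_int m / 2"

lemma pair_term_eq:
  "pair_term m i = ((f1 i * f1 (m - i) - f0 (- i) * f0 (i - m)) +
                    (f0 i * f0 (m - i) - f1 (- i) * f1 (i - m))) / 2"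
proof -
  have f0: "f0 l = f1 l + (a * of_int l + b)" for l using jump[of l] by (simp add: algebra_simps)
  show ?thesis
    unfolding pair_term_def qvir_coeff_even f0 by (simp add: field_simps)
qed

lemma has_sum_pair_term:
  "((\<lambda>i. pair_term m i * q powi (- 2 * i)) has_sum 0) UNIV"
  "((\<lambda>i. pair_term m i * q powi (2 * i)) has_sum 0) UNIV"
proof -
  have "((\<lambda>i. 1 / 2 * ((f1 i * f1 (m - i) - f0 (- i) * f0 (i - m)) * q powi (- 2 * i) +
           (f0 i * f0 (m - i) - f1 (- i) * f1 (i - m)) * q powi (- 2 * i))) has_sum 1 / 2 * (0 + 0)) UNIV"
    by (intro has_sum_cmult_right has_sum_add convolution_cancel_inner convolution_cancel_outer)
  moreover have "1 / 2 * ((f1 i * f1 (m - i) - f0 (- i) * f0 (i - m)) * q powi (- 2 * i) +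
           (f0 i * f0 (m - i) - f1 (- i) * f1 (i - m)) * q powi (- 2 * i)) = pair_term m i * q powi (- 2 * i)" for i
    unfolding pair_term_eq by (simp only: distrib_right times_divide_eq_left mult_1 add_divide_distrib)
  ultimately show 1: "((\<lambda>i. pair_term m i * q powi (- 2 * i)) has_sum 0) UNIV" by simp
  have "((\<lambda>i. q powi (2 * m) * (pair_term m i * q powi (- 2 * i))) has_sum q powi (2 * m) * 0) UNIV"
    by (intro has_sum_cmult_right 1)
  moreover have "pair_term m i * q powi (2 * i) = q powi (2 * m) * (pair_term m (m - i) * q powi (- 2 * (m - i)))" for i
  proof -
    have "q powi (2 * m) * q powi (- 2 * (m - i)) = q powi (2 * i)"
      using pq_bounds by (subst power_int_add [symmetric]) auto
    moreover have "pair_term m (m - i) = pair_term m i"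
      by (simp add: pair_term_def mult.commute)
    ultimately show ?thesis by (simp only: mult.left_commute [of "q powi (2 * m)"])
  qed
  ultimately show "((\<lambda>i. pair_term m i * q powi (2 * i)) has_sum 0) UNIV"
    by (subst has_sum_reindex_bij_witness[where i = "\<lambda>i. m - i" and j = "\<lambda>i. m - i" and T = UNIV and s' = 0
       and h = "\<lambda>i. q powi (2 * m) * (pair_term m i * q powi (- 2 * i))"]) auto
qed

lemma has_sum_pair_term_shift:
  "((\<lambda>k. pair_term m (k - n) * (q powi (s - 2 * k) - q powi (2 * k - s))) has_sum 0) UNIV"
proof -
  have "((\<lambda>i. q powi (s - 2 * n) * (pair_term m i * q powi (- 2 * i)) -
          q powi (2 * n - s) * (pair_term m i * q powi (2 * i))) has_sum
          q powi (s - 2 * n) * 0 - q powi (2 * n - s) * 0) UNIV"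
    by (intro has_sum_diff has_sum_cmult_right has_sum_pair_term)
  hence *: "((\<lambda>i. q powi (s - 2 * n) * (pair_term m i * q powi (- 2 * i)) -
          q powi (2 * n - s) * (pair_term m i * q powi (2 * i))) has_sum 0) UNIV" by simp
  have eq: "q powi (s - 2 * n) * (pair_term m (k - n) * q powi (- 2 * (k - n))) -
          q powi (2 * n - s) * (pair_term m (k - n) * q powi (2 * (k - n))) =
        pair_term m (k - n) * (q powi (s - 2 * k) - q powi (2 * k - s))" for k
  proof -
    have "q powi (s - 2 * n) * q powi (- 2 * (k - n)) = q powi (s - 2 * k)"
         "q powi (2 * n - s) * q powi (2 * (k - n)) = q powi (2 * k - s)"
      using pq_bounds by (subst power_int_add [symmetric]; simp add: algebra_simps)+
    moreover have "c * (t * d) - c' * (t * d') = t * (c * d - c' * d')" for c d c' d' t :: complex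
      by (simp add: algebra_simps)
    ultimately show ?thesis by (simp only:)
  qed
  show ?thesis
    by (subst has_sum_reindex_bij_witness[where i = "\<lambda>i. i + n" and j = "\<lambda>k. k - n" and T = UNIV and s' = 0
       and h = "\<lambda>i. q powi (s - 2 * n) * (pair_term m i * q powi (- 2 * i)) -
          q powi (2 * n - s) * (pair_term m i * q powi (2 * i))"]) (use * eq in auto)
qed

lemma cocycle_coeff_even:
  "cocycle_coeff (qvir_coeff p q) (2 * n) (2 * m) (2 * r) (2 * s) (2 * k) =
     pair_term (s - r - n) (k - n) + pair_term (s - n - m) (k - m) + pair_term (s - m - r) (k - r) -
     a * b * (3 * of_int s - 2 * of_int (n + m + r)) / 2"
proof -
  have idx: "2 * k - 2 * n = 2 * (k - n)" "2 * s - 2 * r - 2 * k = 2 * (s - r - n - (k - n))"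
    "2 * n - 2 * k = 2 * - (k - n)" "2 * k + 2 * r - 2 * s = 2 * (k - n - (s - r - n))" for n m r s k :: int
    by simp_all
  show ?thesis
    unfolding cocycle_coeff_def idx pair_term_def by (simp add: field_simps)
qed

lemma central_extension_condition_even:
  "(\<lambda>N::nat. \<Sum>k | even k \<and> \<bar>2 * k - 2 * s\<bar> \<le> int N.
      cocycle_coeff (qvir_coeff p q) (2 * n) (2 * m) (2 * r) (2 * s) k *
        (x * (q powi ((2 * s - k - k) div 2) - q powi ((k - (2 * s - k)) div 2)))) \<longlonglongrightarrow> 0"
proof -
  define h where "h k = q powi (s - 2 * k) - q powi (2 * k - s)" for k
  define P where "P k = pair_term (s - r - n) (k - n) * h k + pair_term (s - n - m) (k - m) * h k +
     pair_term (s - m - r) (k - r) * h k" for k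
  define C where "C = a * b * (3 * of_int s - 2 * of_int (n + m + r)) / 2"
  define W where "W N = {k. \<bar>2 * (2 * k) - 2 * s\<bar> \<le> int N}" for N
  have fin: "finite (W N)" for N
  proof (rule finite_subset)
    show "W N \<subseteq> {- \<bar>s\<bar> - int N..\<bar>s\<bar> + int N}"
    proof
      fix k assume "k \<in> W N"
      hence "\<bar>2 * (2 * k) - 2 * s\<bar> \<le> int N" by (simp add: W_def)
      hence "- \<bar>s\<bar> - int N \<le> k" "k \<le> \<bar>s\<bar> + int N"
        unfolding abs_if by (auto split: if_splits)
      thus "k \<in> {- \<bar>s\<bar> - int N..\<bar>s\<bar> + int N}" by simp
    qed
  qed simp
  have "(P has_sum 0 + 0 + 0) UNIV"
    unfolding P_def h_def by (intro has_sum_add has_sum_pair_term_shift)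
  hence "(sum P \<longlongrightarrow> 0) (finite_subsets_at_top UNIV)" by (simp add: has_sum_def)
  moreover have "filterlim W (finite_subsets_at_top UNIV) sequentially"
    unfolding filterlim_finite_subsets_at_top
  proof (intro allI impI)
    fix X :: "int set" assume X: "finite X \<and> X \<subseteq> UNIV"
    define B where "B = nat (\<Sum>k\<in>X. \<bar>2 * (2 * k) - 2 * s\<bar>)"
    have "X \<subseteq> W N" if "N \<ge> B" for N
    proof
      fix k assume "k \<in> X"
      hence "\<bar>2 * (2 * k) - 2 * s\<bar> \<le> (\<Sum>k\<in>X. \<bar>2 * (2 * k) - 2 * s\<bar>)"
        using X by (intro member_le_sum) auto
      thus "k \<in> W N" using that unfolding W_def B_def by simp
    qed
    thus "\<forall>\<^sub>F N in sequentially. finite (W N) \<and> X \<subseteq> W N \<and> W N \<subseteq> UNIV"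
      using fin by (auto simp: eventually_sequentially)
  qed
  ultimately have P: "(\<lambda>N. sum P (W N)) \<longlonglongrightarrow> 0" by (rule filterlim_compose)
  have h0: "sum h (W N) = 0" for N
  proof -
    have "\<bar>2 * (2 * (s - k)) - 2 * s\<bar> = \<bar>2 * (2 * k) - 2 * s\<bar>" for k by simp
    hence "s - k \<in> W N \<longleftrightarrow> k \<in> W N" for k by (simp only: W_def mem_Collect_eq)
    moreover have "h (s - k) = - h k" for k by (simp add: h_def algebra_simps)
    ultimately have "sum h (W N) = sum (\<lambda>k. - h k) (W N)"
      by (intro sum.reindex_bij_witness[of _ "\<lambda>k. s - k" "\<lambda>k. s - k"]) auto
    hence "sum h (W N) = - sum h (W N)" by (simp add: sum_negf)
    thus ?thesis by simp
  qed
  have "(\<Sum>k | even k \<and> \<bar>2 * k - 2 * s\<bar> \<le> int N.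
      cocycle_coeff (qvir_coeff p q) (2 * n) (2 * m) (2 * r) (2 * s) k *
        (x * (q powi ((2 * s - k - k) div 2) - q powi ((k - (2 * s - k)) div 2)))) = x * sum P (W N)" (is "?L = _") for N
  proof -
    have "?L = (\<Sum>k\<in>W N. cocycle_coeff (qvir_coeff p q) (2 * n) (2 * m) (2 * r) (2 * s) (2 * k) * (x * h k))"
    proof (rule sum.reindex_bij_witness[of _ "\<lambda>k. 2 * k" "\<lambda>k. k div 2"])
      fix k assume "k \<in> {k. even k \<and> \<bar>2 * k - 2 * s\<bar> \<le> int N}"
      then obtain j where k: "k = 2 * j" "\<bar>2 * (2 * j) - 2 * s\<bar> \<le> int N" by auto
      show "2 * (k div 2) = k" using k by simp
      show "k div 2 \<in> W N" using k by (simp add: W_def)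
      have "(2 * s - k - k) div 2 = s - 2 * j" "(k - (2 * s - k)) div 2 = 2 * j - s"
        using k by simp_all
      thus "cocycle_coeff (qvir_coeff p q) (2 * n) (2 * m) (2 * r) (2 * s) (2 * (k div 2)) * (x * h (k div 2)) =
        cocycle_coeff (qvir_coeff p q) (2 * n) (2 * m) (2 * r) (2 * s) k *
          (x * (q powi ((2 * s - k - k) div 2) - q powi ((k - (2 * s - k)) div 2)))"
        using k by (simp add: h_def)
    qed (auto simp: W_def)
    also have "\<dots> = (\<Sum>k\<in>W N. x * P k - x * C * h k)"
      unfolding cocycle_coeff_even P_def C_def[symmetric]
      by (rule sum.cong) (simp_all add: ring_distribs mult_ac)
    also have "\<dots> = x * sum P (W N) - x * C * sum h (W N)"
      by (simp only: sum_subtractf sum_distrib_left)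
    finally show ?thesis by (simp add: h0)
  qed
  thus ?thesis using tendsto_mult[OF tendsto_const[of x] P] by simp
qed

end

end

end

theorem theorem1:
  fixes p q :: complex and \<xi> :: "int \<Rightarrow> complex"
  assumes "0 < norm q" and "norm q \<le> norm p" and "norm p < 1"
  shows "central_extension_cocycle (qvir_coeff p q)
           (\<lambda>n m. \<xi> (n + m) * (q powi ((n - m) div 2) - q powi ((m - n) div 2)))"
proof -
  let ?R = "1 / (norm p * (norm q)\<^sup>2)"
  have R: "?R > 1" using pq_bounds[OF assms] by (simp add: field_simps)
  show ?thesis
  proof (rule double_pole_expansions[OF qnum_holomorphic[OF assms] R])
    fix f0 f1 a b
    assume f:
      "\<And>x. norm x < 1 \<Longrightarrow> ((\<lambda>l. f0 l * x powi l) has_sum qnum p q x / (1 - x)\<^sup>2) UNIV"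
      "\<And>x. 1 < norm x \<Longrightarrow> norm x < ?R \<Longrightarrow> ((\<lambda>l. f1 l * x powi l) has_sum qnum p q x / (1 - x)\<^sup>2) UNIV"
      "\<And>l. f0 l - f1 l = a * of_int l + b"
    show ?thesis
      unfolding central_extension_cocycle_def
    proof (intro conjI allI impI)
      fix n m r s :: int
      assume "even n" "even m" "even r" "even s"
      then obtain n' m' r' s' where e: "n = 2 * n'" "m = 2 * m'" "r = 2 * r'" "s = 2 * s'"
        by (auto elim!: evenE)
      show "(\<lambda>N::nat. \<Sum>k | even k \<and> \<bar>2 * k - s\<bar> \<le> int N. cocycle_coeff (qvir_coeff p q) n m r s k *
          (\<xi> (s - k + k) * (q powi ((s - k - k) div 2) - q powi ((k - (s - k)) div 2)))) \<longlonglongrightarrow> 0"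
        using central_extension_condition_even[OF assms f, where x = "\<xi> s" and s = s' and n = n' and m = m' and r = r']
        by (simp add: e)
    qed (simp add: add.commute algebra_simps)
  qed
qed

end
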